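(* For positive integers $X$, let $S(X)=\left\{m : m=\left\lfloor \frac{X}{n}\right\rfloor \text{ for some positive integer } n\le X\right\}$. Then $$|S(X)|=2\sqrt{X}+O(1),$$ that is, there is an absolute constant $C$ such that $\left||S(X)|-2\sqrt{X}\right|\le C$ for every positive integer $X$.
   Context: The variables $m$ and $n$ range over positive integers. For a real number $y$, $\lfloor y\rfloor$ denotes the greatest integer not exceeding $y$. $|S(X)|$ denotes the cardinality of the set $S(X)$ (distinct values are counted once). *)

theory Defs
  imports Complex_Main
begin

definition S :: "nat \<Rightarrow> nat set" where
  "S X = {m. m > 0 \<and> (\<exists>n::nat. 1 \<le> n \<and> n \<le> X \<and> int m = \<lfloor>real X / real n\<rfloor>)}"

end

theory Submission
  imports Defs "HOL-Library.Discrete_Functions"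
begin

text \<open>
  For \<open>m \<le> \<surd>X\<close> one has \<open>X div (X div m) = m\<close>. Hence every \<open>m \<le> \<surd>X\<close> is a value, and the
  arguments \<open>n \<le> \<surd>X\<close> give pairwise distinct values; these two families cover all values
  and share at most the number \<open>\<lfloor>\<surd>X\<rfloor>\<close>.
\<close>

lemma S_eq_image_div: "S X = (\<lambda>n. X div n) ` {1..X}"
proof -
  have "int m = \<lfloor>real X / real n\<rfloor> \<longleftrightarrow> m = X div n" for m n
    by (metis floor_divide_of_nat_eq of_nat_eq_iff)
  moreover have "X div n > 0" if "1 \<le> n" "n \<le> X" for n
    using that by (simp add: div_greater_zero_iff)
  ultimately show ?thesis
    by (auto simp: S_def)
qed

text \<open>Euclidean division with the two factors swapped: in
  \<open>X = X div m * m + X mod m\<close> the remainder is below \<open>m\<close>, and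
  \<open>m\<^sup>2 \<le> X\<close> gives \<open>m \<le> X div m\<close>. So the remainder is also
  below \<open>X div m\<close>, and the same equation divides \<open>X\<close> by
  \<open>X div m\<close> with quotient \<open>m\<close>.\<close>

lemma div_div_self_of_square_le:
  fixes m X :: nat
  assumes "1 \<le> m" "m\<^sup>2 \<le> X"
  shows "X div (X div m) = m"
proof -
  have "m \<le> X div m"
    using assms by (simp add: less_eq_div_iff_mult_less_eq power2_eq_square)
  moreover have "X mod m < m"
    using assms by simp
  ultimately have "X mod m < X div m"
    by linarith
  moreover have "X = X div m * m + X mod m"
    by simp
  ultimately show ?thesis
    by (metis div_nat_eqI le_add1 mult.commute mult_Suc_right nat_add_left_cancel_less add.commute)
qed

lemma floor_sqrt_le_div:
  assumes "1 \<le> n" "n \<le> floor_sqrt X"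
  shows "floor_sqrt X \<le> X div n"
proof -
  have "floor_sqrt X * n \<le> (floor_sqrt X)\<^sup>2"
    using assms by (simp add: power2_eq_square)
  also have "\<dots> \<le> X"
    by simp
  finally show ?thesis
    using assms by (simp add: less_eq_div_iff_mult_less_eq)
qed

lemma div_le_floor_sqrt:
  assumes "floor_sqrt X < n"
  shows "X div n \<le> floor_sqrt X"
proof -
  have "X < (Suc (floor_sqrt X))\<^sup>2"
    by (rule Suc_floor_sqrt_power2_gt)
  also have "\<dots> \<le> Suc (floor_sqrt X) * n"
    using assms unfolding power2_eq_square by (intro mult_le_mono) auto
  finally show ?thesis
    using assms by (metis less_Suc_eq_le less_mult_imp_div_less)
qed

lemma
  fixes X :: nat
  defines "k \<equiv> floor_sqrt X"
  shows card_S_le: "card (S X) \<le> 2 * k"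
    and card_S_ge: "2 * k \<le> card (S X) + 1"
proof -
  define B where "B = (\<lambda>n. X div n) ` {1..k}"
  have "k \<le> X"
    by (simp add: k_def floor_sqrt_le)
  have div_div: "X div (X div m) = m" if "m \<in> {1..k}" for m
    using that div_div_self_of_square_le[of m X]
    by (simp add: k_def le_floor_sqrt_iff)
  \<comment> \<open>By \<open>div_div\<close> the map is its own left inverse on this range.\<close>
  have "inj_on (\<lambda>n. X div n) {1..k}"
    by (metis div_div inj_onI)
  then have card_B: "card B = k"
    by (simp add: B_def card_image)
  have S_eq: "S X = {1..k} \<union> B"
  proof (intro equalityI subsetI)
    fix m assume "m \<in> S X"
    then obtain n where n: "1 \<le> n" "n \<le> X" "m = X div n"
      by (auto simp: S_eq_image_div)
    then have "1 \<le> m"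
      by (simp add: less_eq_div_iff_mult_less_eq)
    \<comment> \<open>Arguments up to \<open>k\<close> land in \<open>B\<close>; larger ones have
      quotient at most \<open>k\<close>.\<close>
    then show "m \<in> {1..k} \<union> B"
      using n div_le_floor_sqrt[of X n] by (cases "n \<le> k") (auto simp: B_def k_def)
  next
    fix m assume "m \<in> {1..k} \<union> B"
    then show "m \<in> S X"
    proof
      assume m: "m \<in> {1..k}"
      \<comment> \<open>The argument producing \<open>m\<close> is \<open>X div m\<close>; it is
        positive because it is at least \<open>k\<close>, and
        \<open>k \<ge> m \<ge> 1\<close>.\<close>
      then have "k \<le> X div m"
        using floor_sqrt_le_div by (simp add: k_def)
      then have "X div m \<in> {1..X}"
        using m by (auto intro: order_trans)
      then show ?thesis
        unfolding S_eq_image_div using div_div[OF m] by (metis image_eqI)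
    next
      assume "m \<in> B"
      then show ?thesis
        using \<open>k \<le> X\<close> by (auto simp: B_def S_eq_image_div)
    qed
  qed
  show "card (S X) \<le> 2 * k"
    using card_Un_le[of "{1..k}" B] by (simp add: S_eq card_B)
  \<comment> \<open>Elements of \<open>B\<close> are at least \<open>k\<close>, so only
    \<open>k\<close> can be counted twice; this is the 1 in the lower bound.\<close>
  have "{1..k} \<inter> B \<subseteq> {k}"
    using floor_sqrt_le_div[of _ X] by (auto simp: B_def k_def intro: le_antisym)
  then have "card ({1..k} \<inter> B) \<le> 1"
    using card_mono[of "{k}"] by fastforce
  moreover have "card {1..k} + card B = card ({1..k} \<union> B) + card ({1..k} \<inter> B)"
    by (intro card_Un_Int) (auto simp: B_def)
  ultimately show "2 * k \<le> card (S X) + 1"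
    by (simp add: S_eq card_B)
qed

lemma floor_sqrt_le_sqrt: "real (floor_sqrt X) \<le> sqrt (real X)"
  by (intro real_le_rsqrt) (metis floor_sqrt_power2_le of_nat_le_iff of_nat_power)

lemma sqrt_less_Suc_floor_sqrt: "sqrt (real X) < real (floor_sqrt X) + 1"
proof (rule real_less_lsqrt)
  show "real X < (real (floor_sqrt X) + 1)\<^sup>2"
    by (metis Suc_floor_sqrt_power2_gt of_nat_Suc of_nat_less_iff of_nat_power add.commute)
qed auto

theorem theorem1p2:
  shows "\<exists>C::real. \<forall>X::nat. X \<ge> 1 \<longrightarrow> \<bar>real (card (S X)) - 2 * sqrt (real X)\<bar> \<le> C"
proof (intro exI allI impI)
  fix X :: nat
  \<comment> \<open>With \<open>k = floor_sqrt X\<close>, the cardinality is at most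
    \<open>2 * k \<le> 2 * sqrt X\<close> and at least
    \<open>2 * k - 1 > 2 * (sqrt X - 1) - 1\<close>, which yields 3.\<close>
  show "\<bar>real (card (S X)) - 2 * sqrt (real X)\<bar> \<le> 3"
    using card_S_le[of X] card_S_ge[of X] floor_sqrt_le_sqrt[of X] sqrt_less_Suc_floor_sqrt[of X]
    by linarith
qed

end
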